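(* Let $G^!=(V,E)$ be a directed graph with vertex set $V=\{v_1,\ldots,v_K\}$, loops allowed but at most one directed edge for each ordered pair of vertices, where each vertex $v$ carries a length $\sharp(v)\in\mathbb{N}$ and a size $|v|\in\mathbb{N}$, such that $\sharp(v_1)=|v_1|=0$, $\sharp(v_k)$ and $|v_k|$ are positive integers for $2\le k\le K$, and for every $1\le k\le K$ there is a directed edge from $v_k$ to $v_1$. Let $S$ be a positive integer. Let $\mathscr{A}$ be the adjacency matrix of $G^!$ and $\mathscr{W}(x)=\operatorname{diag}\big(x^{\sharp(v_1)}q^{|v_1|},\ldots,x^{\sharp(v_K)}q^{|v_K|}\big)$. Let $\mathcal{W}^\star$ be the set of infinite walks $w^\star=\varpi_0\to\varpi_1\to\varpi_2\to\cdots$ in $G^!$ (consecutive vertices joined by a directed edge) that are eventually constant equal to $v_1$, with weight $\mathscr{G}(w^\star\,|\,x,q)=\prod_{m\ge 0}(xq^{mS})^{\sharp(\varpi_m)}q^{|\varpi_m|}$ (a finite product, since all but finitely many factors are $1$). For $1\le k\le K$ let $\mathscr{G}_k(G^!\,|\,x)=\sum_{w^\star\in\mathcal{W}^\star,\ \varpi_0=v_k}\mathscr{G}(w^\star\,|\,x,q)$. Then, for $|q|<1$ and $|x|<|q|^{-1}$, $$\begin{pmatrix}\mathscr{G}_1(G^!\,|\,x)\\ \vdots\\ \mathscr{G}_K(G^!\,|\,x)\end{pmatrix}=\mathscr{W}(x)\cdot\left(\lim_{M\to\infty}\mathscr{A}\,\mathscr{W}(xq^{S})\,\mathscr{A}\,\mathscr{W}(xq^{2S})\cdots\mathscr{A}\,\mathscr{W}(xq^{MS})\right)\cdot\begin{pmatrix}1\\0\\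 \vdots\\0\end{pmatrix}.$$ *)

theory Defs
  imports "HOL-Analysis.Analysis"
begin

text \<open>
  The vertex set is a finite type \<open>'v\<close> (so \<open>K = CARD('v)\<close>) with a distinguished vertex \<open>v1\<close>;
  apart from \<open>v1\<close> the numbering of the vertices plays no role. Edges form a relation
  \<open>E :: ('v \<times> 'v) set\<close>: loops are allowed and multiple edges are excluded.
\<close>

definition adjacency_matrix :: "('v::finite \<times> 'v) set \<Rightarrow> complex ^ 'v ^ 'v" where
  "adjacency_matrix E = (\<chi> i j. if (i, j) \<in> E then 1 else 0)"

definition weight_matrix ::
  "('v::finite \<Rightarrow> nat) \<Rightarrow> ('v \<Rightarrow> nat) \<Rightarrow> complex \<Rightarrow> complex \<Rightarrow> complex ^ 'v ^ 'v" where
  "weight_matrix len sz q x = (\<chi> i j. if i = j then x ^ len i * q ^ sz i else 0)"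

definition infinite_walks :: "('v \<times> 'v) set \<Rightarrow> 'v \<Rightarrow> (nat \<Rightarrow> 'v) set" where
  "infinite_walks E v1 =
     {w. (\<forall>m. (w m, w (Suc m)) \<in> E) \<and> (\<forall>\<^sub>F m in sequentially. w m = v1)}"

definition walk_weight ::
  "('v \<Rightarrow> nat) \<Rightarrow> ('v \<Rightarrow> nat) \<Rightarrow> nat \<Rightarrow> complex \<Rightarrow> complex \<Rightarrow> (nat \<Rightarrow> 'v) \<Rightarrow> complex" where
  "walk_weight len sz S q x w = (\<Prod>m. (x * q ^ (m * S)) ^ len (w m) * q ^ sz (w m))"

definition walk_gf ::
  "('v \<times> 'v) set \<Rightarrow> 'v \<Rightarrow> ('v \<Rightarrow> nat) \<Rightarrow> ('v \<Rightarrow> nat) \<Rightarrow> nat \<Rightarrow> complex \<Rightarrow> complex \<Rightarrow> 'v \<Rightarrow> complex" where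
  "walk_gf E v1 len sz S q x k =
     (\<Sum>\<^sub>\<infinity>w\<in>{w \<in> infinite_walks E v1. w 0 = k}. walk_weight len sz S q x w)"

primrec transfer_product ::
  "('v::finite \<times> 'v) set \<Rightarrow> ('v \<Rightarrow> nat) \<Rightarrow> ('v \<Rightarrow> nat) \<Rightarrow> nat \<Rightarrow> complex \<Rightarrow> complex \<Rightarrow> nat
     \<Rightarrow> complex ^ 'v ^ 'v" where
  "transfer_product E len sz S q x 0 = mat 1"
| "transfer_product E len sz S q x (Suc M) =
     transfer_product E len sz S q x M **
       (adjacency_matrix E ** weight_matrix len sz q (x * q ^ (Suc M * S)))"

end

theory Submission
  imports Defs
begin

text \<open>
  Up to the factor \<open>\<W>(x)\<close>, the \<open>(k, j)\<close> entry of the \<open>M\<close>-th transfer product is the weighted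
  count of the \<open>M\<close>-step walks from \<open>k\<close> to \<open>j\<close>. For \<open>j = v1\<close> these walks, continued by \<open>v1\<close>, form
  an increasing exhaustion of the infinite walks by finite sets. The transfer products converge
  because the weights at step \<open>m\<close> of the vertices other than \<open>v1\<close> are \<open>O(|q| ^ m)\<close>, and each row
  changes by a summable amount. Applied to \<open>|q|\<close> and \<open>|x|\<close>, the same convergence bounds the sums of
  absolute values, so the generating functions converge absolutely and may be evaluated along
  the exhaustion.
\<close>

section \<open>Convergence of the transfer products\<close>

text \<open>Each step multiplies the l1 norm of the row by at most 1 + n * \<open>g M\<close>, so
  the rows stay bounded. The entries off \<open>v1\<close> are then O(\<open>g M\<close>), and they
  sum to the increments of the entry at \<open>v1\<close>.\<close>

lemma perturbed_absorbing_recursion_convergent: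
  fixes a :: "nat \<Rightarrow> 'v::finite \<Rightarrow> complex" and A :: "'v \<Rightarrow> 'v \<Rightarrow> complex"
    and c :: "nat \<Rightarrow> 'v \<Rightarrow> complex" and g :: "nat \<Rightarrow> real"
  assumes rec: "\<And>M j. a (Suc M) j = (\<Sum>k\<in>UNIV. a M k * A k j) * c M j"
    and A_le: "\<And>k j. norm (A k j) \<le> 1"
    and A_v1: "\<And>k. A k v1 = 1"
    and c_v1: "\<And>M. c M v1 = 1"
    and c_le: "\<And>M j. j \<noteq> v1 \<Longrightarrow> norm (c M j) \<le> g M"
    and g_nonneg: "\<And>M. 0 \<le> g M" and g_summable: "summable g"
  shows "convergent (\<lambda>M. a M j)"
proof -
  define R where "R M = (\<Sum>k\<in>UNIV. norm (a M k))" for M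
  define n where "n = real (CARD('v))"
  \<comment> \<open>Since 1 + t \<le> exp t, the product of the growth factors 1 + n *
    \<open>g m\<close> is at most the exponential of n times the series.\<close>
  define B where "B = R 0 * exp (n * suminf g)"
  have R_nonneg: "0 \<le> R M" for M
    by (simp add: R_def sum_nonneg)
  have n_nonneg: "0 \<le> n"
    by (simp add: n_def)
  have row: "norm (\<Sum>k\<in>UNIV. a M k * A k j) \<le> R M" for M j
    unfolding R_def
    by (rule order_trans[OF norm_sum], intro sum_mono)
       (auto simp: norm_mult intro!: mult_left_le A_le)
  have off: "norm (a (Suc M) j) \<le> R M * g M" if "j \<noteq> v1" for M j
    unfolding rec norm_mult using row c_le[OF that] R_nonneg by (intro mult_mono) auto
  have R_Suc: "R (Suc M) \<le> R M * (1 + n * g M)" for M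
  proof -
    have "R (Suc M) = norm (a (Suc M) v1) + (\<Sum>k\<in>UNIV - {v1}. norm (a (Suc M) k))"
      unfolding R_def by (simp add: sum.remove[of UNIV v1])
    also have "norm (a (Suc M) v1) \<le> R M"
      using row[of M v1] by (simp add: rec c_v1)
    also have "(\<Sum>k\<in>UNIV - {v1}. norm (a (Suc M) k)) \<le> (\<Sum>k\<in>UNIV - {v1}. R M * g M)"
      by (intro sum_mono off) auto
    \<comment> \<open>Counting \<open>v1\<close> as well only enlarges the bound and gives the
      factor n.\<close>
    also have "\<dots> \<le> (\<Sum>k\<in>(UNIV::'v set). R M * g M)"
      by (intro sum_mono2) (auto simp: R_nonneg g_nonneg)
    finally show ?thesis
      by (simp add: n_def algebra_simps)
  qed
  have R_le: "R M \<le> R 0 * exp (n * (\<Sum>m<M. g m))" for M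
  proof (induction M)
    case (Suc M)
    have "R (Suc M) \<le> R M * (1 + n * g M)"
      by (rule R_Suc)
    also have "\<dots> \<le> (R 0 * exp (n * (\<Sum>m<M. g m))) * exp (n * g M)"
      by (intro mult_mono Suc.IH exp_ge_add_one_self) (auto simp: R_nonneg n_nonneg g_nonneg)
    finally show ?case
      by (simp add: distrib_left exp_add)
  qed simp
  have R_le_B: "R M \<le> B" for M
  proof -
    have "(\<Sum>m<M. g m) \<le> suminf g"
      by (intro sum_le_suminf g_summable g_nonneg ballI) auto
    then have "R 0 * exp (n * (\<Sum>m<M. g m)) \<le> B"
      unfolding B_def using R_nonneg n_nonneg by (intro mult_left_mono) (auto intro: mult_left_mono)
    with R_le[of M] show ?thesis by linarith
  qed
  have off_B: "norm (a (Suc M) j) \<le> B * g M" if "j \<noteq> v1" for M j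
    using off[OF that, of M] mult_right_mono[OF R_le_B[of M] g_nonneg[of M]] by linarith
  have B_summable: "summable (\<lambda>M. B * g M)"
    by (intro summable_mult g_summable)
  show ?thesis
  proof (cases "j = v1")
    case False
    have "(\<lambda>M. a (Suc M) j) \<longlonglongrightarrow> 0"
      by (rule Lim_null_comparison[OF _ summable_LIMSEQ_zero[OF B_summable]])
         (simp add: off_B[OF False])
    then show ?thesis
      using convergentI convergent_Suc_iff[of "\<lambda>M. a M j"] by blast
  next
    case True
    \<comment> \<open>Column \<open>v1\<close> consists of ones, so the new entry at
      \<open>v1\<close> is the sum of the whole previous row. The indices start at
      \<open>Suc M\<close> because \<open>off_B\<close> says nothing about the arbitrary initial
      row.\<close>
    have diff: "a (Suc (Suc M)) v1 - a (Suc M) v1 = (\<Sum>k\<in>UNIV - {v1}. a (Suc M) k)" for M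
      by (subst rec) (simp add: A_v1 c_v1 sum.remove[of UNIV v1])
    have "summable (\<lambda>M. a (Suc (Suc M)) v1 - a (Suc M) v1)"
      unfolding diff
      by (intro summable_sum summable_comparison_test'[OF B_summable]) (auto intro: off_B)
    then have "convergent (\<lambda>M. \<Sum>m<M. a (Suc (Suc m)) v1 - a (Suc m) v1)"
      by (simp add: summable_iff_convergent)
    then have "convergent (\<lambda>M. a (Suc M) v1 - a (Suc 0) v1)"
      by (simp only: sum_lessThan_telescope[of "\<lambda>m. a (Suc m) v1"])
    then have "convergent (\<lambda>M. a (Suc M) v1 - a (Suc 0) v1 + a (Suc 0) v1)"
      by (rule convergent_add) (rule convergent_const)
    then show ?thesis
      using True convergent_Suc_iff[of "\<lambda>M. a M v1"] by simp
  qed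
qed

lemma matrix_convergentI:
  fixes P :: "nat \<Rightarrow> complex ^ 'n::finite ^ 'm::finite"
  assumes "\<And>i j. convergent (\<lambda>M. P M $ i $ j)"
  shows "convergent P"
proof -
  have "P \<longlonglongrightarrow> (\<chi> i j. lim (\<lambda>M. P M $ i $ j))"
    using assms by (intro vec_tendstoI) (simp add: convergent_LIMSEQ_iff)
  then show ?thesis by (rule convergentI)
qed

lemma matrix_mult_weight_matrix:
  "(A ** weight_matrix len sz q x) $ i $ j = A $ i $ j * (x ^ len j * q ^ sz j)"
  by (simp add: matrix_matrix_mult_def weight_matrix_def if_distrib cong: if_cong)

lemma weight_matrix_mult:
  "(weight_matrix len sz q x ** A) $ i $ j = x ^ len i * q ^ sz i * A $ i $ j"
  by (simp add: matrix_matrix_mult_def weight_matrix_def if_distrib if_distribR cong: if_cong)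

lemma transfer_product_Suc_nth:
  "transfer_product E len sz S q x (Suc M) $ i $ j =
     (\<Sum>k\<in>UNIV. transfer_product E len sz S q x M $ i $ k * (if (k, j) \<in> E then 1 else 0))
       * ((x * q ^ (Suc M * S)) ^ len j * q ^ sz j)"
  by (simp add: matrix_mul_assoc matrix_mult_weight_matrix)
     (simp add: matrix_matrix_mult_def adjacency_matrix_def)

text \<open>As \<open>Suc M * S\<close> is at least 1, the bound on |x| |q| keeps the base at norm
  at most 1. Hence its positive power \<open>l\<close> is no larger than the base itself, which
  decays geometrically.\<close>

lemma norm_step_weight_le:
  fixes q x :: complex
  assumes "0 < l" and "0 < S" and "norm q < 1" and xq: "norm x * norm q < 1"
  shows "norm ((x * q ^ (Suc M * S)) ^ l * q ^ s) \<le> norm x * norm q * norm q ^ M"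
proof -
  have q_le: "norm q \<le> 1"
    using assms by simp
  have "Suc M \<le> Suc M * S"
    using \<open>0 < S\<close> by (cases S) auto
  then have "norm q ^ (Suc M * S) \<le> norm q ^ Suc M"
    using q_le by (intro power_decreasing) auto
  then have le: "norm (x * q ^ (Suc M * S)) \<le> norm x * norm q * norm q ^ M"
    by (simp add: norm_mult norm_power mult.assoc mult_left_mono)
  also have "\<dots> \<le> norm x * norm q"
    using q_le by (intro mult_left_le power_le_one) auto
  also have "\<dots> \<le> 1"
    using xq by simp
  finally have le1: "norm (x * q ^ (Suc M * S)) \<le> 1" .
  have "norm ((x * q ^ (Suc M * S)) ^ l * q ^ s)
      = norm (x * q ^ (Suc M * S)) ^ l * norm q ^ s"
    by (simp only: norm_mult norm_power)
  also have "\<dots> \<le> norm (x * q ^ (Suc M * S)) ^ l"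
    using q_le by (intro mult_left_le power_le_one zero_le_power) auto
  also have "\<dots> \<le> norm (x * q ^ (Suc M * S)) ^ 1"
    using \<open>0 < l\<close> le1 by (intro power_decreasing) auto
  finally show ?thesis
    using le by simp
qed

lemma transfer_product_convergent:
  fixes E :: "('v::finite \<times> 'v) set" and q x :: complex
  assumes "len v1 = 0" and "sz v1 = 0"
    and "\<And>v. v \<noteq> v1 \<Longrightarrow> 0 < len v"
    and "\<And>v. (v, v1) \<in> E"
    and "0 < S" and "norm q < 1" and "norm x * norm q < 1"
  shows "convergent (transfer_product E len sz S q x)"
proof (rule matrix_convergentI)
  fix i j
  show "convergent (\<lambda>M. transfer_product E len sz S q x M $ i $ j)"
  \<comment> \<open>Each row i evolves by itself. The edges into \<open>v1\<close> provide the
    column of ones, and the vanishing length and size of \<open>v1\<close> make its step weight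
    1.\<close>
  proof (rule perturbed_absorbing_recursion_convergent[where
        A = "\<lambda>k j. if (k, j) \<in> E then 1 else 0" and
        c = "\<lambda>M j. (x * q ^ (Suc M * S)) ^ len j * q ^ sz j" and ?v1.0 = v1])
    show "norm ((x * q ^ (Suc M * S)) ^ len j * q ^ sz j) \<le> norm x * norm q * norm q ^ M"
      if "j \<noteq> v1" for M j
      using that assms by (intro norm_step_weight_le) auto
    show "summable (\<lambda>M. norm x * norm q * norm q ^ M)"
      using \<open>norm q < 1\<close> by (intro summable_mult summable_geometric) simp
  qed (use assms in \<open>auto simp only: transfer_product_Suc_nth, auto\<close>)
qed

section \<open>Finite walks and the exhaustion of the infinite walks\<close>

text \<open>Padding by \<open>v1\<close> makes an \<open>M\<close>-step walk a function on all of
  \<open>nat\<close>, so that it can be compared with infinite walks. The endpoint \<open>j\<close>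
  is kept general for the induction on \<open>M\<close>.\<close>

definition padded_walks :: "('v \<times> 'v) set \<Rightarrow> 'v \<Rightarrow> nat \<Rightarrow> 'v \<Rightarrow> 'v \<Rightarrow> (nat \<Rightarrow> 'v) set" where
  "padded_walks E v1 M k j =
     {w. w 0 = k \<and> (\<forall>m<M. (w m, w (Suc m)) \<in> E) \<and> w M = j \<and> (\<forall>m>M. w m = v1)}"

lemma finite_padded_walks: "finite (padded_walks E (v1::'v::finite) M k j)"
proof -
  have "padded_walks E v1 M k j \<subseteq> {w. \<forall>m. (m \<in> {..M} \<longrightarrow> w m \<in> UNIV) \<and> (m \<notin> {..M} \<longrightarrow> w m = v1)}"
    by (auto simp: padded_walks_def)
  then show ?thesis
    by (rule finite_subset) (intro finite_set_of_finite_funs; simp)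
qed

text \<open>The last edge is split off: a walk corresponds to its vertex at time \<open>M\<close>
  together with the walk whose entry at \<open>Suc M\<close> is reset to the padding value.\<close>

lemma sum_padded_walks_Suc:
  fixes h :: "(nat \<Rightarrow> 'v::finite) \<Rightarrow> 'a::comm_monoid_add"
  shows "(\<Sum>w\<in>padded_walks E v1 (Suc M) k j. h w) =
    (\<Sum>l\<in>{l. (l, j) \<in> E}. \<Sum>w\<in>padded_walks E v1 M k l. h (w(Suc M := j)))"
proof -
  have "(\<Sum>w\<in>padded_walks E v1 (Suc M) k j. h w) =
      (\<Sum>(l, w)\<in>(SIGMA l:{l. (l, j) \<in> E}. padded_walks E v1 M k l). h (w(Suc M := j)))"
    by (rule sum.reindex_bij_witness[of _ "\<lambda>(l, w). w(Suc M := j)" "\<lambda>w. (w M, w(Suc M := v1))"])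
       (auto simp: padded_walks_def fun_eq_iff less_Suc_eq intro!: arg_cong[of _ _ h])
  also have "\<dots> = (\<Sum>l\<in>{l. (l, j) \<in> E}. \<Sum>w\<in>padded_walks E v1 M k l. h (w(Suc M := j)))"
    by (subst sum.Sigma) (auto simp: finite_padded_walks)
  finally show ?thesis .
qed

text \<open>The leading weight matrix supplies the factor m = 0, and every further step supplies an
  edge and the weight of the vertex reached.\<close>

lemma weighted_transfer_product_nth:
  "(weight_matrix len sz q x ** transfer_product E len sz S q x M) $ k $ j =
     (\<Sum>w\<in>padded_walks E v1 M k j. \<Prod>m\<le>M. (x * q ^ (m * S)) ^ len (w m) * q ^ sz (w m))"
proof (induction M arbitrary: j)
  case 0
  have "padded_walks E v1 0 k j = (if k = j then {(\<lambda>_. v1)(0 := k)} else {})"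
    by (auto simp: padded_walks_def fun_eq_iff)
  then show ?case
    by (simp add: weight_matrix_mult mat_def)
next
  case (Suc M)
  define f where "f m v = (x * q ^ (m * S)) ^ len v * q ^ sz v" for m v
  define T where "T M = transfer_product E len sz S q x M" for M
  have "(weight_matrix len sz q x ** T (Suc M)) $ k $ j =
      (\<Sum>l\<in>UNIV. (weight_matrix len sz q x ** T M) $ k $ l * (if (l, j) \<in> E then 1 else 0))
        * f (Suc M) j"
    unfolding T_def weight_matrix_mult transfer_product_Suc_nth f_def
    by (simp add: sum_distrib_left mult.assoc)
  also have "(\<Sum>l\<in>UNIV. (weight_matrix len sz q x ** T M) $ k $ l * (if (l, j) \<in> E then 1 else 0))
      = (\<Sum>l\<in>{l. (l, j) \<in> E}. \<Sum>w\<in>padded_walks E v1 M k l. \<Prod>m\<le>M. f m (w m))"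
    unfolding T_def Suc.IH f_def by (intro sum.mono_neutral_cong_right) auto
  \<comment> \<open>The update at \<open>Suc M\<close> leaves the factors up to \<open>M\<close>
    unchanged and contributes \<open>f (Suc M) j\<close>.\<close>
  also have "\<dots> * f (Suc M) j = (\<Sum>l\<in>{l. (l, j) \<in> E}. \<Sum>w\<in>padded_walks E v1 M k l.
      \<Prod>m\<le>Suc M. f m ((w(Suc M := j)) m))"
    by (simp add: sum_distrib_right)
  also have "\<dots> = (\<Sum>w\<in>padded_walks E v1 (Suc M) k j. \<Prod>m\<le>Suc M. f m (w m))"
    by (simp only: sum_padded_walks_Suc)
  finally show ?case
    by (simp only: T_def f_def)
qed

lemma walk_weight_eq_prod:
  assumes "len v1 = 0" and "sz v1 = 0" and "\<And>m. m > M \<Longrightarrow> w m = v1"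
  shows "walk_weight len sz S q x w = (\<Prod>m\<le>M. (x * q ^ (m * S)) ^ len (w m) * q ^ sz (w m))"
  unfolding walk_weight_def by (rule prodinf_finite) (use assms in auto)

lemma sum_walk_weight_padded_walks:
  assumes "len v1 = 0" and "sz v1 = 0"
  shows "(\<Sum>w\<in>padded_walks E v1 M k j. walk_weight len sz S q x w) =
    (weight_matrix len sz q x ** transfer_product E len sz S q x M) $ k $ j"
  unfolding weighted_transfer_product_nth[where ?v1.0 = v1]
  by (intro sum.cong refl walk_weight_eq_prod[where ?v1.0 = v1] assms) (auto simp: padded_walks_def)

text \<open>The loop at \<open>v1\<close> turns the padding into genuine steps of an infinite
  walk.\<close>

lemma padded_walks_v1_eq:
  assumes "(v1, v1) \<in> E"
  shows "padded_walks E v1 M k v1 = {w \<in> infinite_walks E v1. w 0 = k \<and> (\<forall>m\<ge>M. w m = v1)}"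
proof (intro set_eqI iffI)
  fix w assume w: "w \<in> padded_walks E v1 M k v1"
  then have tail: "w m = v1" if "m \<ge> M" for m
    using that by (cases "m = M") (auto simp: padded_walks_def)
  have "(w m, w (Suc m)) \<in> E" for m
    using w tail assms by (cases "m < M") (auto simp: padded_walks_def)
  with w tail show "w \<in> {w \<in> infinite_walks E v1. w 0 = k \<and> (\<forall>m\<ge>M. w m = v1)}"
    by (auto simp: padded_walks_def infinite_walks_def eventually_sequentially)
qed (auto simp: padded_walks_def infinite_walks_def)

text \<open>Every walk belongs to these sets once it has settled at \<open>v1\<close>, and finitely
  many walks do so by a common time. A summable family can therefore be summed along this
  sequence.\<close>

lemma filterlim_padded_walks:
  assumes "(v1, v1) \<in> E"
  shows "filterlim (\<lambda>M. padded_walks E v1 M k (v1::'v::finite))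
    (finite_subsets_at_top {w \<in> infinite_walks E v1. w 0 = k}) sequentially"
  unfolding filterlim_finite_subsets_at_top
proof safe
  fix X assume "finite X" and X: "X \<subseteq> {w \<in> infinite_walks E v1. w 0 = k}"
  have "\<forall>\<^sub>F M in sequentially. w \<in> padded_walks E v1 M k v1" if "w \<in> X" for w
  proof -
    from that X obtain N where "\<forall>m\<ge>N. w m = v1"
      by (force simp: infinite_walks_def eventually_sequentially)
    with that X show ?thesis
      unfolding padded_walks_v1_eq[OF assms] eventually_sequentially by (intro exI[of _ N]) auto
  qed
  with \<open>finite X\<close> have "\<forall>\<^sub>F M in sequentially. \<forall>w\<in>X. w \<in> padded_walks E v1 M k v1"
    by (simp add: eventually_ball_finite)
  then show "\<forall>\<^sub>F M in sequentially. finite (padded_walks E v1 M k v1) \<and>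
      X \<subseteq> padded_walks E v1 M k v1 \<and>
      padded_walks E v1 M k v1 \<subseteq> {w \<in> infinite_walks E v1. w 0 = k}"
    by (rule eventually_mono)
       (intro conjI finite_padded_walks; auto simp: padded_walks_v1_eq[OF assms])
qed

section \<open>Absolute summability and evaluation of the generating functions\<close>

text \<open>Sums of norms are again sums of walk weights, now at |q| and |x|. The embedding into the
  complex numbers lets the transfer product apply to them.\<close>

lemma of_real_norm_walk_weight:
  assumes "len v1 = 0" and "sz v1 = 0" and "w \<in> infinite_walks E v1"
  shows "complex_of_real (norm (walk_weight len sz S q x w)) =
    walk_weight len sz S (of_real (norm q)) (of_real (norm x)) w"
proof -
  from assms(3) obtain M where "\<And>m. m > M \<Longrightarrow> w m = v1"
    unfolding infinite_walks_def eventually_sequentially by (auto dest: less_imp_le)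
  note eq = walk_weight_eq_prod[where M = M and len = len and sz = sz and ?v1.0 = v1, OF assms(1,2) this]
  show ?thesis
    by (simp add: eq prod_norm[symmetric] norm_mult norm_power)
qed

text \<open>Every finite subset of \<open>A\<close> lies in some \<open>F M\<close>, so
  \<open>C\<close> bounds all finite sums of norms.\<close>

lemma summable_on_if_bounded_along:
  fixes f :: "'a \<Rightarrow> complex"
  assumes F: "filterlim F (finite_subsets_at_top A) sequentially"
    and bounded: "\<And>M. (\<Sum>w\<in>F M. norm (f w)) \<le> C"
  shows "f summable_on A"
proof (rule abs_summable_summable)
  show "(\<lambda>w. norm (f w)) summable_on A"
  proof (rule nonneg_bdd_above_summable_on)
    show "bdd_above (sum (\<lambda>w. norm (f w)) ` {X. X \<subseteq> A \<and> finite X})"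
    proof (rule bdd_aboveI2)
      fix X assume "X \<in> {X. X \<subseteq> A \<and> finite X}"
      with F have "\<forall>\<^sub>F M in sequentially. finite (F M) \<and> X \<subseteq> F M \<and> F M \<subseteq> A"
        by (auto simp: filterlim_finite_subsets_at_top)
      then obtain M where "finite (F M)" "X \<subseteq> F M"
        by (auto simp: eventually_sequentially)
      then have "(\<Sum>w\<in>X. norm (f w)) \<le> (\<Sum>w\<in>F M. norm (f w))"
        by (intro sum_mono2) auto
      also have "\<dots> \<le> C"
        by (rule bounded)
      finally show "(\<Sum>w\<in>X. norm (f w)) \<le> C" .
    qed
  qed simp
qed

text \<open>Summability and convergence are asserted explicitly because the infinite sum defaults to
  0 and \<open>lim\<close> is unspecified when they fail.\<close>

theorem theorem2p2:
  fixes E :: "('v::finite \<times> 'v) set" and v1 :: 'v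
    and len sz :: "'v \<Rightarrow> nat" and S :: nat and q x :: complex
  assumes "len v1 = 0" and "sz v1 = 0"
    and "\<And>v. v \<noteq> v1 \<Longrightarrow> 0 < len v" and "\<And>v. v \<noteq> v1 \<Longrightarrow> 0 < sz v"
    and "\<And>v. (v, v1) \<in> E"
    and "0 < S"
    and "norm q < 1" and "q \<noteq> 0 \<Longrightarrow> norm x < inverse (norm q)"
  shows "(\<forall>k. walk_weight len sz S q x summable_on {w \<in> infinite_walks E v1. w 0 = k})
    \<and> convergent (transfer_product E len sz S q x)
    \<and> (\<chi> k. walk_gf E v1 len sz S q x k) =
        (weight_matrix len sz q x ** lim (transfer_product E len sz S q x)) *v axis v1 1"
proof -
  \<comment> \<open>The product form also covers q = 0, where \<open>inverse 0 = 0\<close> and x is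
    arbitrary.\<close>
  have xq: "norm x * norm q < 1"
    using assms(8) by (cases "q = 0") (auto simp: field_simps)
  note sum_eq = sum_walk_weight_padded_walks[where len = len and sz = sz and ?v1.0 = v1, OF assms(1,2)]
  note exhaust = filterlim_padded_walks[OF assms(5)]
  \<comment> \<open>The parameters are general because this is used at (|q|, |x|) for summability
    and at (q, x) for the value.\<close>
  have entry_tendsto: "(\<lambda>M. \<Sum>w\<in>padded_walks E v1 M k v1. walk_weight len sz S q' x' w)
      \<longlonglongrightarrow> (weight_matrix len sz q' x' ** lim (transfer_product E len sz S q' x')) $ k $ v1"
    if "norm q' < 1" "norm x' * norm q' < 1" for q' x' k
  proof -
    have "convergent (transfer_product E len sz S q' x')"
      using assms that by (intro transfer_product_convergent[where ?v1.0 = v1]) auto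
    then show ?thesis
      unfolding sum_eq weight_matrix_mult convergent_LIMSEQ_iff by (intro tendsto_intros)
  qed
  have summable: "walk_weight len sz S q x summable_on {w \<in> infinite_walks E v1. w 0 = k}" for k
  proof -
    define s where "s M = (\<Sum>w\<in>padded_walks E v1 M k v1. norm (walk_weight len sz S q x w))" for M
    have "complex_of_real (s M) = (\<Sum>w\<in>padded_walks E v1 M k v1.
        walk_weight len sz S (of_real (norm q)) (of_real (norm x)) w)" for M
      unfolding s_def of_real_sum
      by (intro sum.cong refl of_real_norm_walk_weight[where E = E and ?v1.0 = v1] assms)
         (simp add: padded_walks_v1_eq assms)
    then have "convergent (\<lambda>M. complex_of_real (s M))"
      using entry_tendsto[of "of_real (norm q)" "of_real (norm x)" k] assms(7) xq
      by (auto intro: convergentI)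
    then obtain C where "\<And>M. norm (complex_of_real (s M)) \<le> C"
      using convergent_imp_Bseq BseqE by metis
    then have "s M \<le> C" for M
      by (metis abs_le_D1 norm_of_real)
    then show ?thesis
      unfolding s_def by (rule summable_on_if_bounded_along[OF exhaust])
  qed
  have "walk_gf E v1 len sz S q x k =
      (weight_matrix len sz q x ** lim (transfer_product E len sz S q x)) $ k $ v1" for k
  proof (rule LIMSEQ_unique)
    show "(\<lambda>M. \<Sum>w\<in>padded_walks E v1 M k v1. walk_weight len sz S q x w)
        \<longlonglongrightarrow> walk_gf E v1 len sz S q x k"
      unfolding walk_gf_def
      by (rule filterlim_compose[OF infsum_tendsto[OF summable] exhaust])
  qed (rule entry_tendsto[OF assms(7) xq])
  then have "(\<chi> k. walk_gf E v1 len sz S q x k) =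
      (weight_matrix len sz q x ** lim (transfer_product E len sz S q x)) *v axis v1 1"
    by (simp add: vec_eq_iff matrix_vector_mult_def axis_def if_distrib cong: if_cong)
  then show ?thesis
    using summable assms xq transfer_product_convergent[of len v1 sz E S q x] by blast
qed

end
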